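(* Let $k\ge 1$ be an integer. Every online-simulation by deterministic machines with $k$ queues of deterministic machines having as storage (i) one tape and one pushdown store, or (ii) two tapes, or (iii) three pushdown stores, requires $\Omega(n^{1+1/k}/\log^{1/k} n)$ steps, where $n$ is the number of steps being simulated. That is, for each of the storage types (i), (ii), (iii) there is a deterministic machine $M$ with this storage such that every deterministic machine $Q$ with $k$ queues that simulates $M$ online satisfies $T_Q(n)=\Omega(n^{1+1/k}/\log^{1/k} n)$, where $T_Q(n)$ denotes the maximum number of steps $Q$ needs in order to simulate the first $n$ steps of $M$, over all inputs.
   Context: All machines have a finite control, a separate one-way read-only input tape, and produce a sequence of output symbols. A machine with $k$ queues has $k$ first-in-first-out queues as storage; in one step, determined by its finite control, it can read zero or one symbol from the input, pop zero or one symbol from the front of a queue, push zero or one symbol onto the rear of a queue, produce output, and change state. Machines with tapes (linear two-way read-write Turing tapes) or pushdown stores are defined in the same way, with tapes or pushdown stores in place of queues. A machine $Q$ simulates a machine $M$ online if, on every input, $Q$ produces the same output as $M$, and every output symbol that $M$ produces before reading its next input symbol is also produced by $Q$ before $Q$ reads that next input symbol. *)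

theory Defs
  imports Complex_Main "HOL-Library.Sublist" "HOL-Library.Landau_Symbols"
begin

section \<open>Storage devices\<close>

text \<open>
  The front of a queue and the top of a pushdown store are the heads of the respective lists.
  A tape is a two-way infinite sequence of cells together with the position of its head;
  \<open>None\<close> is the blank.
\<close>

datatype store = Queue "nat list" | Stack "nat list" | Tape "int \<Rightarrow> nat option" int

definition empty_queue :: store where "empty_queue = Queue []"
definition empty_stack :: store where "empty_stack = Stack []"
definition blank_tape :: store where "blank_tape = Tape (\<lambda>_. None) 0"

datatype move = MoveLeft | Stay | MoveRight

datatype action = Idle | Push nat | Write "nat option" move

text \<open>
  A step accesses a device in two phases.  First, if the finite control asks for it, one symbol
  is popped (queue, pushdown store) or the scanned cell is read (tape); an empty queue or
  pushdown store yields \<open>None\<close>.  Then an action that may depend on the symbols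
  obtained is performed; an action of the wrong kind for a device has no effect.
\<close>

fun pop_list :: "nat list \<Rightarrow> nat option \<times> nat list" where
  "pop_list [] = (None, [])"
| "pop_list (a # xs) = (Some a, xs)"

fun fetch :: "bool \<Rightarrow> store \<Rightarrow> nat option \<times> store" where
  "fetch False s = (None, s)"
| "fetch True (Queue xs) = map_prod id Queue (pop_list xs)"
| "fetch True (Stack xs) = map_prod id Stack (pop_list xs)"
| "fetch True (Tape f p) = (f p, Tape f p)"

fun shift :: "move \<Rightarrow> int \<Rightarrow> int" where
  "shift MoveLeft p = p - 1"
| "shift Stay p = p"
| "shift MoveRight p = p + 1"

fun act :: "action \<Rightarrow> store \<Rightarrow> store" where
  "act (Push a) (Queue xs) = Queue (xs @ [a])"
| "act (Push a) (Stack xs) = Stack (a # xs)"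
| "act (Write c m) (Tape f p) = Tape (f(p := c)) (shift m p)"
| "act _ s = s"

section \<open>Deterministic machines\<close>

text \<open>
  States and symbols are coded by natural numbers.  The current state alone decides whether an
  input symbol is read and which devices are popped or read; \<open>delta\<close> then maps the
  state, the input symbol and the symbols fetched from the devices to the next state, one action
  per device, and the (possibly empty) word that is output in this step.  In particular a machine
  knows nothing about its next input symbol before it reads it.
\<close>

record machine =
  storage :: "store list"
  states :: "nat set"
  inputs :: "nat set"
  symbols :: "nat set"
  start :: nat
  reads :: "nat \<Rightarrow> bool"
  fetches :: "nat \<Rightarrow> bool list"
  delta :: "nat \<Rightarrow> nat option \<Rightarrow> nat option list \<Rightarrow> nat \<times> action list \<times> nat list"

fun action_over :: "nat set \<Rightarrow> action \<Rightarrow> bool" where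
  "action_over G Idle \<longleftrightarrow> True"
| "action_over G (Push a) \<longleftrightarrow> a \<in> G"
| "action_over G (Write c m) \<longleftrightarrow> set_option c \<subseteq> G"

text \<open>
  The finiteness conditions make the relevant part of \<open>delta\<close> a finite table; hence only
  finitely many output words, and so only finitely many output symbols, occur.
\<close>

definition is_machine :: "machine \<Rightarrow> bool" where
  "is_machine M \<longleftrightarrow>
     finite (states M) \<and> finite (inputs M) \<and> finite (symbols M) \<and> start M \<in> states M \<and>
     (\<forall>q \<in> states M. length (fetches M q) = length (storage M)) \<and>
     (\<forall>q \<in> states M. \<forall>a obs q' acts w.
        set_option a \<subseteq> inputs M \<and>
        length obs = length (storage M) \<and> (\<forall>c \<in> set obs. set_option c \<subseteq> symbols M) \<and>
        delta M q a obs = (q', acts, w) \<longrightarrow>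
        q' \<in> states M \<and> length acts = length (storage M) \<and>
        (\<forall>b \<in> set acts. action_over (symbols M) b))"

text \<open>
  A configuration consists of the state, the unread input, the contents of the devices and the
  output produced so far.  Reading at the end of the input yields \<open>None\<close>.
\<close>

type_synonym config = "nat \<times> nat list \<times> store list \<times> nat list"

fun step :: "machine \<Rightarrow> config \<Rightarrow> config" where
  "step M (q, xs, ss, out) =
     (let (a, xs') = (if reads M q then pop_list xs else (None, xs));
          fs = map2 fetch (fetches M q) ss;
          (q', acts, w) = delta M q a (map fst fs)
      in (q', xs', map2 act acts (map snd fs), out @ w))"

definition run :: "machine \<Rightarrow> nat list \<Rightarrow> nat \<Rightarrow> config" where
  "run M x t = (step M ^^ t) (start M, x, storage M, [])"

text \<open>Number of input symbols read, and output produced, in the first \<open>t\<close> steps.\<close>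

definition consumed :: "machine \<Rightarrow> nat list \<Rightarrow> nat \<Rightarrow> nat" where
  "consumed M x t = (case run M x t of (q, xs, ss, out) \<Rightarrow> length x - length xs)"

definition produced :: "machine \<Rightarrow> nat list \<Rightarrow> nat \<Rightarrow> nat list" where
  "produced M x t = (case run M x t of (q, xs, ss, out) \<Rightarrow> out)"

section \<open>Online simulation\<close>

text \<open>
  Machines need not halt, so the total output is a possibly infinite sequence; two such sequences
  are equal iff every finite part of either one is eventually produced by the other machine.
\<close>

definition same_output :: "machine \<Rightarrow> machine \<Rightarrow> nat list \<Rightarrow> bool" where
  "same_output Q M x \<longleftrightarrow>
     (\<forall>t. \<exists>s. prefix (produced M x t) (produced Q x s)) \<and>
     (\<forall>s. \<exists>t. prefix (produced Q x s) (produced M x t))"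

text \<open>
  If \<open>M\<close> has read \<open>r\<close> symbols after \<open>t\<close> steps, its output so
  far is output produced before reading symbol number \<open>r + 1\<close>, so \<open>Q\<close>
  has to produce it while having read at most \<open>r\<close> symbols.
\<close>

definition simulates_online :: "machine \<Rightarrow> machine \<Rightarrow> bool" where
  "simulates_online Q M \<longleftrightarrow>
     inputs M \<subseteq> inputs Q \<and>
     (\<forall>x \<in> lists (inputs M).
        same_output Q M x \<and>
        (\<forall>t. \<exists>s. consumed Q x s \<le> consumed M x t \<and> prefix (produced M x t) (produced Q x s)))"

definition sim_steps :: "machine \<Rightarrow> machine \<Rightarrow> nat \<Rightarrow> nat list \<Rightarrow> nat" where
  "sim_steps Q M n x = (LEAST s. prefix (produced M x n) (produced Q x s))"

definition sim_time :: "machine \<Rightarrow> machine \<Rightarrow> nat \<Rightarrow> nat" where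
  "sim_time Q M n = Max (sim_steps Q M n ` lists (inputs M))"

lemma run_Suc: "run M x (Suc t) = step M (run M x t)"
  by (simp add: run_def)

lemma step_rest:
  assumes "step M (q, xs, ss, out) = (q', xs', ss', out')"
  shows "xs' = (if reads M q then tl xs else xs)"
  using assms by (cases xs) (auto simp: Let_def split: prod.splits if_splits)

lemma run_prefix:
  assumes "run M (z @ u) t = (q, xs, ss, out)" "u \<noteq> []" "length u \<le> length xs"
  shows "\<exists>z'. xs = z' @ u \<and> run M (z @ v) t = (q, z' @ v, ss, out)"
  using assms
proof (induction t arbitrary: q xs ss out)
  case 0
  then show ?case by (auto simp: run_def)
next
  case (Suc t)
  obtain q0 xs0 ss0 out0 where r0: "run M (z @ u) t = (q0, xs0, ss0, out0)"
    by (metis prod_cases4)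
  have st: "step M (q0, xs0, ss0, out0) = (q, xs, ss, out)"
    using Suc.prems(1) r0 by (simp add: run_Suc)
  have xs: "xs = (if reads M q0 then tl xs0 else xs0)" by (rule step_rest[OF st])
  have "length u \<le> length xs0" using Suc.prems(3) xs by (auto split: if_splits)
  from Suc.IH[OF r0 Suc.prems(2) this] obtain z' where
    z': "xs0 = z' @ u" "run M (z @ v) t = (q0, z' @ v, ss0, out0)" by blast
  have ne: "z' \<noteq> []" if "reads M q0"
    using that xs z'(1) Suc.prems(2,3) by (cases u) auto
  show ?case
  proof (cases "reads M q0")
    case True
    with ne obtain a z'' where "z' = a # z''" by (cases z') auto
    with True st z' show ?thesis
      by (auto simp: run_Suc Let_def split: prod.splits)
  next
    case False
    with st z' show ?thesis
      by (auto simp: run_Suc Let_def split: prod.splits)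
  qed
qed

lemma consumed_Suc: "consumed M x t \<le> consumed M x (Suc t) \<and> consumed M x (Suc t) \<le> Suc (consumed M x t)"
proof -
  obtain q xs ss out where r0: "run M x t = (q, xs, ss, out)" by (metis prod_cases4)
  obtain q' xs' ss' out' where st: "step M (q, xs, ss, out) = (q', xs', ss', out')"
    by (metis prod_cases4)
  have "xs' = xs \<or> xs' = tl xs" using step_rest[OF st] by simp
  then have "length xs' \<le> length xs \<and> length xs \<le> Suc (length xs')" by auto
  moreover have "consumed M x t = length x - length xs" by (simp add: consumed_def r0)
  moreover have "consumed M x (Suc t) = length x - length xs'"
    by (simp only: consumed_def run_Suc r0 st prod.case)
  ultimately show ?thesis by linarith
qed

lemma consumed_le: "consumed M x t \<le> t"
proof (induction t)
  case 0
  show ?case by (simp add: consumed_def run_def)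
next
  case (Suc t)
  with consumed_Suc[of M x t] show ?case by linarith
qed

lemma consumed_mono: "s \<le> t \<Longrightarrow> consumed M x s \<le> consumed M x t"
  by (rule lift_Suc_mono_le[of "consumed M x"]) (simp_all add: consumed_Suc)

lemma produced_prefix:
  assumes "consumed M (z @ u) t \<le> length z" "u \<noteq> []"
  shows "produced M (z @ v) t = produced M (z @ u) t"
proof -
  obtain q xs ss out where r: "run M (z @ u) t = (q, xs, ss, out)" by (metis prod_cases4)
  have "length u \<le> length xs" using assms(1) r by (simp add: consumed_def)
  from run_prefix[OF r assms(2) this, of v] show ?thesis using r by (auto simp: produced_def)
qed

lemma sim_steps_le:
  assumes sim: "simulates_online Q M" and x: "z @ u \<in> lists (inputs M)"
    and u: "u \<noteq> []" and v: "v \<noteq> []" and lz: "length z = n"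
  shows "sim_steps Q M n (z @ v) \<le> sim_steps Q M n (z @ u)"
proof -
  let ?P = "\<lambda>s. prefix (produced M (z @ u) n) (produced Q (z @ u) s)"
  obtain s0 where s0: "consumed Q (z @ u) s0 \<le> consumed M (z @ u) n" "?P s0"
    using sim x unfolding simulates_online_def by blast
  have "?P (sim_steps Q M n (z @ u))" unfolding sim_steps_def by (rule LeastI, rule s0(2))
  moreover have "sim_steps Q M n (z @ u) \<le> s0"
    unfolding sim_steps_def by (rule Least_le, rule s0(2))
  then have "consumed Q (z @ u) (sim_steps Q M n (z @ u)) \<le> length z"
    using consumed_mono s0(1) consumed_le lz by (metis le_trans)
  moreover have "consumed M (z @ u) n \<le> length z" using consumed_le lz by simp
  ultimately have "prefix (produced M (z @ v) n) (produced Q (z @ v) (sim_steps Q M n (z @ u)))"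
    using produced_prefix[OF _ u, where v = v] by metis
  then show ?thesis unfolding sim_steps_def[of Q M n "z @ v"] by (rule Least_le)
qed

text \<open>
  The maximum in \<open>sim_time\<close> exists: it ranges over a finite set, since only the first
  \<open>n + 1\<close> input symbols matter.
\<close>

lemma finite_sim_steps:
  assumes M: "is_machine M" and sim: "simulates_online Q M"
  shows "finite (sim_steps Q M n ` lists (inputs M))"
proof -
  let ?short = "{x. set x \<subseteq> inputs M \<and> length x \<le> Suc n}"
  have "sim_steps Q M n x \<in> sim_steps Q M n ` ?short" if x: "x \<in> lists (inputs M)" for x
  proof (cases "length x \<le> n")
    case True
    with x show ?thesis by auto
  next
    case False
    define z u where "z = take n x" and "u = drop n x"
    have xzu: "x = z @ u" and lz: "length z = n" and u: "u \<noteq> []"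
      using False by (auto simp: z_def u_def)
    have v: "[hd u] \<noteq> []" by simp
    have zv: "z @ [hd u] \<in> lists (inputs M)"
      using x xzu u by (auto simp: in_lists_conv_set)
    have "sim_steps Q M n (z @ u) = sim_steps Q M n (z @ [hd u])"
      using sim_steps_le[OF sim _ u v lz] sim_steps_le[OF sim zv v u lz] x xzu
      by (simp add: order_antisym)
    moreover have "z @ [hd u] \<in> ?short" using zv lz by auto
    ultimately show ?thesis using xzu by blast
  qed
  then have "sim_steps Q M n ` lists (inputs M) \<subseteq> sim_steps Q M n ` ?short" by blast
  moreover have "finite ?short"
    using M by (intro finite_lists_length_le) (simp add: is_machine_def)
  ultimately show ?thesis by (meson finite_imageI finite_subset)
qed

end

theory Submission
  imports Defs "HOL-Real_Asymp.Real_Asymp"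
begin

text \<open>
  A single pushdown store already forces the bound.  If \<open>Q\<close> spends fewer than \<open>L\<close> steps on
  pushing a random word, doing some work that leaves the store unchanged, and popping the word
  again, then a queue of length \<open>2 L\<close> or more serves only as a supply of old symbols, of which
  just the number already consumed matters.  So the word has to be kept in the other queues, and
  one of these has to be long, unless the word is no longer than the \<open>O(log n)\<close> bits that suffice
  to record the positions in the long queues.  Nest such windows at \<open>k + 1\<close> scales: with
  \<open>l\<close> about \<open>log n\<close>, a window at level \<open>j\<close> pushes about \<open>r\<^sup>j l\<close> bits and contains \<open>r\<close> windows
  of level \<open>j - 1\<close>.  A window that is cheap at level \<open>j\<close> forces one more queue to be long for the
  windows inside it; at level 0 all \<open>k\<close> queues are long, so that already \<open>O(log n)\<close> bits cost
  \<open>r l\<close> steps.  Hence a window at level \<open>k\<close> of about \<open>n = r\<^sup>k l\<close> commands costs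
  \<open>r\<^sup>k\<^sup>+\<^sup>1 l = n (n / l)\<^sup>1\<^sup>/\<^sup>k\<close> steps.
\<close>

section \<open>A machine serving a pushdown store\<close>

text \<open>
  Commands 0 and 1 push that bit and are acknowledged by 2; command 2 pops and is answered by the
  popped bit, or by 3 if the store is empty.
\<close>

fun after :: "nat list \<Rightarrow> nat list \<Rightarrow> nat list" where
  "after [] st = st"
| "after (c # cs) st = after cs (if c < 2 then c # st else tl st)"

fun answers :: "nat list \<Rightarrow> nat list \<Rightarrow> nat list" where
  "answers [] st = []"
| "answers (c # cs) st =
     (if c < 2 then 2 else case st of [] \<Rightarrow> 3 | a # _ \<Rightarrow> a) #
     answers cs (if c < 2 then c # st else tl st)"

abbreviation commands :: "nat set" where "commands \<equiv> {0, 1, 2}"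

lemma after_append: "after (y @ z) st = after z (after y st)"
  by (induction y arbitrary: st) auto

lemma answers_append: "answers (y @ z) st = answers y st @ answers z (after y st)"
  by (induction y arbitrary: st) auto

lemma length_answers [simp]: "length (answers z st) = length z"
  by (induction z arbitrary: st) auto

lemma after_bits: "set x \<subseteq> {0, 1} \<Longrightarrow> after x st = rev x @ st"
  by (induction x arbitrary: st) auto

lemma after_pops: "after (replicate (length l) 2) (l @ st) = st"
  by (induction l) auto

lemma answers_pops: "answers (replicate (length l) 2) (l @ st) = l"
  by (induction l) auto

text \<open>The quantifier over all stores lets a neutral word be inserted at any nesting depth,
  whatever lies beneath it.\<close>

definition neutral :: "nat list \<Rightarrow> bool" where
  "neutral w \<longleftrightarrow> (\<forall>st. after w st = st)"

lemma neutral_Nil: "neutral []"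
  by (simp add: neutral_def)

lemma neutral_append: "neutral v \<Longrightarrow> neutral w \<Longrightarrow> neutral (v @ w)"
  by (simp add: neutral_def after_append)

lemma neutral_window:
  assumes "set x \<subseteq> {0, 1}" "neutral u"
  shows "neutral (x @ u @ replicate (length x) 2)"
  using assms after_pops[of "rev x"] by (simp add: neutral_def after_append after_bits)

text \<open>The arbitrary continuation \<open>u\<close> makes the answers appear before any further
  command is read, which an online simulator has to match. The last clause, about inputs that end,
  will forbid the simulator to answer in advance.\<close>

definition serves :: "machine \<Rightarrow> bool" where
  "serves M \<longleftrightarrow> inputs M = commands \<and>
     (\<forall>z \<in> lists commands.
        (\<forall>u. \<exists>t \<le> 2 * length z. produced M (z @ u) t = answers z [] \<and>
                                consumed M (z @ u) t \<le> length z) \<and>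
        (\<forall>t. prefix (produced M z t) (answers z [])))"

text \<open>State 0 obeys a command and state 1 completes a pop: the state alone decides on a fetch,
  so a pop is read one step before the device is fetched. The devices \<open>ds\<close> stay
  idle.\<close>

definition server ::
  "store \<Rightarrow> store list \<Rightarrow> (nat \<Rightarrow> action) \<Rightarrow> action \<Rightarrow> (nat option \<Rightarrow> action) \<Rightarrow> machine" where
  "server d ds push pre post =
     \<lparr>storage = d # ds, states = {0, 1}, inputs = commands, symbols = {0, 1}, start = 0,
      reads = (\<lambda>q. q = 0),
      fetches = (\<lambda>q. (q = 1) # replicate (length ds) False),
      delta = (\<lambda>q a obs.
        let idle = replicate (length ds) Idle in
        if q = 0 then
          (case a of
             None \<Rightarrow> (0, Idle # idle, [])
           | Some b \<Rightarrow> if b < 2 then (0, push b # idle, [2]) else (1, pre # idle, []))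
        else (0, post (hd obs) # idle, [case hd obs of None \<Rightarrow> 3 | Some b \<Rightarrow> b]))\<rparr>"

lemma is_machine_server:
  assumes "\<And>b. b < 2 \<Longrightarrow> action_over {0, 1} (push b)" "action_over {0, 1} pre"
    "\<And>c. action_over {0, 1} (post c)"
  shows "is_machine (server d ds push pre post)"
  unfolding is_machine_def server_def using assms
  by (auto simp: Let_def split: option.splits if_splits)

lemma fetch_False_devices: "map2 fetch (replicate (length ds) False) ds = map (Pair None) ds"
  by (induction ds) auto

lemma act_Idle [simp]: "act Idle s = s"
  by (cases s) auto

lemma act_Idle_devices: "map2 act (replicate (length ds) Idle) ds = ds"
  by (induction ds) auto

lemma produced_mono: "s \<le> t \<Longrightarrow> prefix (produced M x s) (produced M x t)"
proof (induction rule: dec_induct)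
  case (step t)
  obtain q xs ss out where "run M x t = (q, xs, ss, out)" by (metis prod_cases4)
  then have "prefix (produced M x t) (produced M x (Suc t))"
    by (auto simp: produced_def run_Suc Let_def split: prod.splits)
  with step.IH show ?case by (rule prefix_order.trans)
qed simp

text \<open>\<open>R\<close> is a refinement relation between the abstract store and the first
  device. It only has to survive a push and the two-step pop, since every command starts and ends in
  state 0.\<close>

lemma serves_server:
  fixes R :: "nat list \<Rightarrow> store \<Rightarrow> bool"
  defines "peek \<equiv> \<lambda>st. case st of [] \<Rightarrow> None | a # _ \<Rightarrow> Some a"
  assumes init: "R [] d"
    and push: "\<And>st s b. R st s \<Longrightarrow> b < 2 \<Longrightarrow> R (b # st) (act (push b) s)"
    and pop: "\<And>st s. R st s \<Longrightarrow> \<exists>s'. fetch True (act pre s) = (peek st, s') \<and>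
                 R (tl st) (act (post (peek st)) s')"
  shows "serves (server d ds push pre post)"
proof -
  let ?M = "server d ds push pre post"
  have push_step: "step ?M (0, b # xs, s # ds, out) = (0, xs, act (push b) s # ds, out @ [2])"
    if "b < 2" for b xs s out
    using that by (simp add: server_def fetch_False_devices act_Idle_devices comp_def)
  have pop_steps: "\<exists>s'. (step ?M ^^ 2) (0, b # xs, s # ds, out) =
      (0, xs, s' # ds, out @ [case st of [] \<Rightarrow> 3 | a # _ \<Rightarrow> a]) \<and> R (tl st) s'"
    if b: "\<not> b < 2" and R: "R st s" for b xs s out st
  proof -
    obtain s' where s': "fetch True (act pre s) = (peek st, s')" "R (tl st) (act (post (peek st)) s')"
      using pop[OF R] by blast
    have "step ?M (0, b # xs, s # ds, out) = (1, xs, act pre s # ds, out)"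
      using b by (simp add: server_def fetch_False_devices act_Idle_devices comp_def)
    moreover have "step ?M (1, xs, act pre s # ds, out) =
        (0, xs, act (post (peek st)) s' # ds, out @ [case st of [] \<Rightarrow> 3 | a # _ \<Rightarrow> a])"
      using s'(1)
      by (simp add: server_def fetch_False_devices act_Idle_devices comp_def peek_def split: list.split)
    ultimately show ?thesis using s'(2) by (auto simp: numeral_2_eq_2)
  qed
  have exec: "\<exists>t \<le> 2 * length z. \<exists>s'. (step ?M ^^ t) (0, z @ u, s # ds, out) =
      (0, u, s' # ds, out @ answers z st) \<and> R (after z st) s'"
    if "R st s" for z u st s out
    using that
  proof (induction z arbitrary: st s out)
    case Nil
    then show ?case by (intro exI[of _ 0]) auto
  next
    case (Cons b z)
    let ?a = "if b < 2 then 2 else case st of [] \<Rightarrow> 3 | a # _ \<Rightarrow> a"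
    let ?st = "if b < 2 then b # st else tl st"
    have "\<exists>t0 \<le> 2. \<exists>s0. (step ?M ^^ t0) (0, b # z @ u, s # ds, out) =
        (0, z @ u, s0 # ds, out @ [?a]) \<and> R ?st s0"
    proof (cases "b < 2")
      case True
      then show ?thesis using push_step[OF True] push[OF Cons.prems True]
        by (intro exI[of _ 1]) auto
    next
      case False
      then show ?thesis using pop_steps[OF False Cons.prems] by (intro exI[of _ 2]) auto
    qed
    then obtain t0 s0 where 1: "t0 \<le> 2" "R ?st s0"
      "(step ?M ^^ t0) (0, b # z @ u, s # ds, out) = (0, z @ u, s0 # ds, out @ [?a])" by blast
    obtain t s' where 2: "t \<le> 2 * length z" "R (after z ?st) s'"
      "(step ?M ^^ t) (0, z @ u, s0 # ds, out @ [?a]) = (0, u, s' # ds, (out @ [?a]) @ answers z ?st)"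
      using Cons.IH[OF 1(2)] by blast
    have "(step ?M ^^ (t + t0)) (0, (b # z) @ u, s # ds, out) =
        (0, u, s' # ds, out @ answers (b # z) st)"
      using 1(3) 2(3) by (simp add: funpow_add)
    moreover have "R (after (b # z) st) s'" using 2(2) by simp
    moreover have "t + t0 \<le> 2 * length (b # z)" using 1(1) 2(1) by simp
    ultimately show ?case by blast
  qed
  have run: "\<exists>t \<le> 2 * length z. \<exists>s. run ?M (z @ u) t = (0, u, s # ds, answers z [])" for z u
    using exec[OF init, of z u "[]"] by (auto simp: run_def server_def)
  \<comment> \<open>Once the input is exhausted the machine loops silently, so its output never
    exceeds \<open>answers z []\<close>.\<close>
  have halt: "step ?M (0, [], s # ds, out) = (0, [], s # ds, out)" for s out
    by (simp add: server_def fetch_False_devices act_Idle_devices comp_def)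
  have "prefix (produced ?M z t) (answers z [])" for z t
  proof -
    obtain t0 s where t0: "run ?M z t0 = (0, [], s # ds, answers z [])"
      using run[of z "[]"] by auto
    have "run ?M z (t0 + t) = (0, [], s # ds, answers z [])"
      by (induction t) (use t0 halt in \<open>auto simp: run_Suc\<close>)
    then have "produced ?M z (t0 + t) = answers z []" by (simp add: produced_def)
    with produced_mono[of t "t0 + t" ?M z] show ?thesis by simp
  qed
  moreover have "\<exists>t \<le> 2 * length z. produced ?M (z @ u) t = answers z [] \<and>
      consumed ?M (z @ u) t \<le> length z" for z u
    using run[of z u] by (fastforce simp: produced_def consumed_def)
  ultimately show ?thesis by (simp add: serves_def) (simp add: server_def)
qed

lemma stack_server:
  "\<exists>M. is_machine M \<and> storage M = empty_stack # ds \<and> serves M"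
proof -
  let ?M = "server empty_stack ds Push Idle (\<lambda>_. Idle)"
  have "is_machine ?M" by (rule is_machine_server) auto
  moreover have "serves ?M"
    by (rule serves_server[where R = "\<lambda>st s. s = Stack st"])
      (auto simp: empty_stack_def split: list.split)
  moreover have "storage ?M = empty_stack # ds" by (simp add: server_def)
  ultimately show ?thesis by blast
qed

text \<open>The store lies immediately left of the head, its top in cell \<open>p - 1\<close>, with
  blanks everywhere else; a blank in that cell therefore means that the store is empty.\<close>

definition represents :: "nat list \<Rightarrow> store \<Rightarrow> bool" where
  "represents st s \<longleftrightarrow> (\<exists>p. s = Tape
     (\<lambda>i. if p - int (length st) \<le> i \<and> i < p then Some (st ! nat (p - 1 - i)) else None) p)"

text \<open>
  Popping first moves the head onto the top symbol, without knowing whether there is one; if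
  there is none, the move is undone.
\<close>

lemma tape_server:
  "\<exists>M. is_machine M \<and> storage M = blank_tape # ds \<and> serves M"
proof -
  let ?push = "\<lambda>b. Write (Some b) MoveRight"
  let ?pre = "Write None MoveLeft"
  let ?post = "\<lambda>c. case c of None \<Rightarrow> Write None MoveRight | Some _ \<Rightarrow> Write None Stay"
  let ?M = "server blank_tape ds ?push ?pre ?post"
  have "is_machine ?M" by (rule is_machine_server) (auto split: option.split)
  moreover have "serves ?M"
  proof (rule serves_server[where R = represents])
    show "represents [] blank_tape" by (auto simp: represents_def blank_tape_def)
  next
    fix st s and b :: nat
    assume "represents st s"
    then obtain p where p: "s = Tape
       (\<lambda>i. if p - int (length st) \<le> i \<and> i < p then Some (st ! nat (p - 1 - i)) else None) p"
      by (auto simp: represents_def)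
    have "nat (p - (1 + i)) = nat (p - i) - Suc 0" for i by arith
    then show "represents (b # st) (act (?push b) s)"
      unfolding represents_def p
      by (intro exI[of _ "p + 1"]) (auto simp: fun_eq_iff nth_Cons' diff_diff_eq)
  next
    fix st :: "nat list" and s
    let ?top = "case st of [] \<Rightarrow> None | a # _ \<Rightarrow> Some a"
    assume "represents st s"
    then obtain p where p: "s = Tape
       (\<lambda>i. if p - int (length st) \<le> i \<and> i < p then Some (st ! nat (p - 1 - i)) else None) p"
      by (auto simp: represents_def)
    show "\<exists>s'. fetch True (act ?pre s) = (?top, s') \<and> represents (tl st) (act (?post ?top) s')"
    proof (cases st)
      case Nil
      then show ?thesis unfolding p represents_def by (auto intro!: exI[of _ p])
    next
      case (Cons a st')
      have "nat (p - (2 + i)) = nat (p - (1 + i)) - Suc 0" for i by arith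
      with Cons show ?thesis unfolding p represents_def
        by (auto simp: fun_eq_iff nth_Cons' diff_diff_eq intro!: exI[of _ "p - 1"])
    qed
  qed
  moreover have "storage ?M = blank_tape # ds" by (simp add: server_def)
  ultimately show ?thesis by blast
qed

section \<open>Runs of queue machines\<close>

fun queue_over :: "nat set \<Rightarrow> store \<Rightarrow> bool" where
  "queue_over G (Queue l) \<longleftrightarrow> set l \<subseteq> G"
| "queue_over G _ \<longleftrightarrow> False"

text \<open>The value on other devices is a dummy; well-formed configurations contain only
  queues.\<close>

fun content :: "store \<Rightarrow> nat list" where
  "content (Queue l) = l"
| "content _ = []"

lemma queue_over_content: "queue_over G s \<longleftrightarrow> s = Queue (content s) \<and> set (content s) \<subseteq> G"
  by (cases s) auto

lemma fetch_Queue: "fetch b (Queue l) = (if b then (fst (pop_list l), Queue (tl l)) else (None, Queue l))"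
  by (cases b; cases l) auto

lemma act_Queue: "act a (Queue l) = Queue (case a of Push c \<Rightarrow> l @ [c] | _ \<Rightarrow> l)"
  by (cases a) auto

definition well_formed :: "machine \<Rightarrow> nat \<times> nat list \<times> store list \<times> nat list \<Rightarrow> bool" where
  "well_formed Q = (\<lambda>(q, xs, ss, out). q \<in> states Q \<and> set xs \<subseteq> inputs Q \<and>
     length ss = length (storage Q) \<and> (\<forall>s \<in> set ss. queue_over (symbols Q) s))"

lemma step_queues:
  assumes Q: "is_machine Q" and wf: "well_formed Q (q, xs, ss, out)"
    and st: "step Q (q, xs, ss, out) = (q', xs', ss', out')"
  shows "well_formed Q (q', xs', ss', out')"
    and "i < length (storage Q) \<Longrightarrow> \<exists>p \<le> 1. \<exists>y.
           content (ss' ! i) = drop p (content (ss ! i)) @ y"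
proof -
  define a where "a = (if reads Q q then fst (pop_list xs) else None)"
  define fs where "fs = map2 fetch (fetches Q q) ss"
  obtain acts w where d: "delta Q q a (map fst fs) = (q', acts, w)"
    "ss' = map2 act acts (map snd fs)"
    using st by (auto simp: a_def fs_def Let_def split: prod.splits if_splits)
  have wf': "q \<in> states Q" "set xs \<subseteq> inputs Q" "length ss = length (storage Q)"
    "\<And>s. s \<in> set ss \<Longrightarrow> queue_over (symbols Q) s"
    using wf by (auto simp: well_formed_def)
  have len: "length (fetches Q q) = length (storage Q)" "length fs = length (storage Q)"
    using Q wf' by (auto simp: is_machine_def fs_def)
  have a: "set_option a \<subseteq> inputs Q"
    using wf'(2) by (cases xs) (auto simp: a_def)
  have obs: "set_option (fst (fs ! i)) \<subseteq> symbols Q" if "i < length fs" for i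
  proof -
    have "queue_over (symbols Q) (ss ! i)" using that len wf' by simp
    then show ?thesis using that len wf'(3)
      by (cases "content (ss ! i)") (auto simp: fs_def queue_over_content fetch_Queue)
  qed
  have obs': "\<forall>c \<in> set (map fst fs). set_option c \<subseteq> symbols Q"
    using obs by (fastforce simp: in_set_conv_nth)
  have q': "q' \<in> states Q" "length acts = length (storage Q)"
    "\<And>b. b \<in> set acts \<Longrightarrow> action_over (symbols Q) b"
    using Q wf'(1) a obs' d(1) len(2) unfolding is_machine_def by (metis length_map)+
  have i: "queue_over (symbols Q) (ss' ! i) \<and>
      (\<exists>p \<le> 1. \<exists>y. content (ss' ! i) = drop p (content (ss ! i)) @ y)"
    if i: "i < length (storage Q)" for i
  proof -
    obtain l where l: "ss ! i = Queue l" "set l \<subseteq> symbols Q"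
      using wf'(3) wf'(4)[of "ss ! i"] i by (auto simp: queue_over_content)
    have "ss' ! i = act (acts ! i) (snd (fetch (fetches Q q ! i) (Queue l)))"
      using i len q' wf'(3) l(1) by (simp add: d(2) fs_def)
    moreover have "action_over (symbols Q) (acts ! i)" using q' i by simp
    moreover have "set (tl l) \<subseteq> symbols Q" using l(2) by (cases l) auto
    moreover have "tl l = drop 1 l" "l = drop 0 l" by (auto simp: drop_Suc)
    ultimately show ?thesis using l
      by (cases "acts ! i"; cases "fetches Q q ! i")
        (auto simp: fetch_Queue act_Queue intro: exI[of _ 0] exI[of _ 1])
  qed
  have "set xs' \<subseteq> inputs Q" using step_rest[OF st] wf'(2) by (cases xs) auto
  moreover have "length ss' = length (storage Q)" using q' len by (simp add: d(2))
  ultimately show "well_formed Q (q', xs', ss', out')"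
    using q'(1) i by (auto simp: well_formed_def in_set_conv_nth)
  show "i < length (storage Q) \<Longrightarrow> \<exists>p \<le> 1. \<exists>y.
      content (ss' ! i) = drop p (content (ss ! i)) @ y"
    using i by blast
qed

text \<open>Old symbols leave only at the front, at most one per step, and new ones join only at the
  rear.\<close>

lemma steps_queues:
  assumes Q: "is_machine Q" and wf: "well_formed Q (q, xs, ss, out)"
    and st: "(step Q ^^ t) (q, xs, ss, out) = (q', xs', ss', out')"
  shows "well_formed Q (q', xs', ss', out') \<and> (\<forall>i < length (storage Q). \<exists>p \<le> t. \<exists>y.
           content (ss' ! i) = drop p (content (ss ! i)) @ y)"
  using st
proof (induction t arbitrary: q' xs' ss' out')
  case 0
  then show ?case using wf by (auto intro!: exI[of _ 0])
next
  case (Suc t)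
  obtain q1 xs1 ss1 out1 where 1: "(step Q ^^ t) (q, xs, ss, out) = (q1, xs1, ss1, out1)"
    by (metis prod_cases4)
  have 2: "step Q (q1, xs1, ss1, out1) = (q', xs', ss', out')" using 1 Suc.prems by simp
  have 3: "well_formed Q (q1, xs1, ss1, out1)" using Suc.IH[OF 1] by blast
  have "\<exists>p \<le> Suc t. \<exists>y. content (ss' ! i) = drop p (content (ss ! i)) @ y"
    if i: "i < length (storage Q)" for i
  proof -
    obtain p y where p: "p \<le> t" "content (ss1 ! i) = drop p (content (ss ! i)) @ y"
      using Suc.IH[OF 1] i by blast
    obtain p' y' where p': "p' \<le> 1" "content (ss' ! i) = drop p' (content (ss1 ! i)) @ y'"
      using step_queues(2)[OF Q 3 2 i] by blast
    \<comment> \<open>Once the old symbols have run out, a further pop takes from the new part; the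
      second \<open>drop\<close> accounts for it.\<close>
    then have "content (ss' ! i) =
        drop (p' + p) (content (ss ! i)) @ drop (p' - (length (content (ss ! i)) - p)) y @ y'"
      using p(2) by simp
    moreover have "p' + p \<le> Suc t" using p p' by simp
    ultimately show ?thesis by blast
  qed
  then show ?case using step_queues(1)[OF Q 3 2] by blast
qed

text \<open>The queues cannot be told apart within \<open>N\<close> steps.\<close>

definition alike :: "nat \<Rightarrow> store \<Rightarrow> store \<Rightarrow> bool" where
  "alike N s s' \<longleftrightarrow> (\<exists>l l'. s = Queue l \<and> s' = Queue l' \<and>
     (l = l' \<or> N \<le> length l \<and> N \<le> length l' \<and> take N l = take N l'))"

lemma alike_fetch:
  assumes "alike (Suc N) s s'"
  shows "fst (fetch b s) = fst (fetch b s') \<and> alike N (snd (fetch b s)) (snd (fetch b s'))"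
proof -
  obtain l l' where l: "s = Queue l" "s' = Queue l'"
    "l = l' \<or> Suc N \<le> length l \<and> Suc N \<le> length l' \<and> take (Suc N) l = take (Suc N) l'"
    using assms by (auto simp: alike_def)
  show ?thesis
  proof (cases "l = l'")
    case True
    then show ?thesis by (auto simp: l(1,2) fetch_Queue alike_def)
  next
    case False
    with l(3) have 1: "Suc N \<le> length l" "Suc N \<le> length l'" "take (Suc N) l = take (Suc N) l'"
      by auto
    then obtain a m a' m' where "l = a # m" "l' = a' # m'" by (metis Suc_le_length_iff)
    moreover have "take N l = take N l'" using 1(3) by (metis Suc_n_not_le_n nat_le_linear take_all_iff min.absorb1 take_take)
    ultimately show ?thesis using 1 by (auto simp: l(1,2) fetch_Queue alike_def)
  qed
qed

lemma alike_act: "alike N s s' \<Longrightarrow> alike N (act a s) (act a s')"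
  by (auto simp: alike_def act_Queue split: action.split)

lemma step_alike:
  assumes "list_all2 (alike (Suc N)) ss ss'"
  shows "\<exists>q1 xs1 ss1 ss1' w. step Q (q, xs, ss, out) = (q1, xs1, ss1, out @ w) \<and>
           step Q (q, xs, ss', out') = (q1, xs1, ss1', out' @ w) \<and> list_all2 (alike N) ss1 ss1'"
proof -
  define fs where "fs = map2 fetch (fetches Q q) ss"
  define fs' where "fs' = map2 fetch (fetches Q q) ss'"
  have "list_all2 (\<lambda>f f'. fst f = fst f' \<and> alike N (snd f) (snd f')) fs fs'"
    using assms alike_fetch by (auto simp: list_all2_conv_all_nth fs_def fs'_def)
  then have obs: "map fst fs = map fst fs'"
    and al: "list_all2 (alike N) (map snd fs) (map snd fs')"
    by (auto simp: list_all2_conv_all_nth list_eq_iff_nth_eq)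
  obtain a xs1 where a: "(if reads Q q then pop_list xs else (None, xs)) = (a, xs1)"
    by fastforce
  obtain q1 acts w where d: "delta Q q a (map fst fs) = (q1, acts, w)" by (metis prod_cases3)
  have "list_all2 (alike N) (map2 act acts (map snd fs)) (map2 act acts (map snd fs'))"
    using al alike_act by (auto simp: list_all2_conv_all_nth)
  moreover have "step Q (q, xs, ss, out) = (q1, xs1, map2 act acts (map snd fs), out @ w)"
    using a d by (simp add: fs_def)
  moreover have "step Q (q, xs, ss', out') = (q1, xs1, map2 act acts (map snd fs'), out' @ w)"
    using a d[unfolded obs] by (simp add: fs'_def)
  ultimately show ?thesis by blast
qed

text \<open>Each step uses up at most one of the common front symbols, so for \<open>N\<close> steps
  every fetch gives the same result in both runs; hence states, input positions and new output
  agree.\<close>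

lemma steps_alike:
  assumes "list_all2 (alike N) ss ss'" "t \<le> N"
  shows "\<exists>q1 xs1 ss1 ss1' w. (step Q ^^ t) (q, xs, ss, out) = (q1, xs1, ss1, out @ w) \<and>
           (step Q ^^ t) (q, xs, ss', out') = (q1, xs1, ss1', out' @ w) \<and>
           list_all2 (alike (N - t)) ss1 ss1'"
  using assms(2)
proof (induction t)
  case 0
  then show ?case using assms(1) by simp
next
  case (Suc t)
  then obtain q1 xs1 ss1 ss1' w where 1:
    "(step Q ^^ t) (q, xs, ss, out) = (q1, xs1, ss1, out @ w)"
    "(step Q ^^ t) (q, xs, ss', out') = (q1, xs1, ss1', out' @ w)"
    "list_all2 (alike (N - t)) ss1 ss1'" by auto
  have "N - t = Suc (N - Suc t)" using Suc.prems by simp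
  with 1(3) have "list_all2 (alike (Suc (N - Suc t))) ss1 ss1'" by simp
  from step_alike[OF this, of Q q1 xs1 "out @ w" "out' @ w"] 1(1,2) show ?case by auto
qed

lemma run_add: "run M x (s + t) = (step M ^^ t) (run M x s)"
  by (simp add: run_def funpow_add add.commute[of s])

lemma run_suffix: "run M x t = (q, xs, ss, out) \<Longrightarrow> suffix xs x"
proof (induction t arbitrary: q xs ss out)
  case 0
  then show ?case by (simp add: run_def)
next
  case (Suc t)
  obtain q0 xs0 ss0 out0 where r0: "run M x t = (q0, xs0, ss0, out0)" by (metis prod_cases4)
  with Suc.prems have "step M (q0, xs0, ss0, out0) = (q, xs, ss, out)" by (simp add: run_Suc)
  from step_rest[OF this] have "suffix xs xs0" by (simp add: suffix_tl)
  with Suc.IH[OF r0] show ?case by (meson suffix_order.trans)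
qed

section \<open>Costly windows\<close>

definition words :: "nat \<Rightarrow> nat list set" where
  "words m = {x. set x \<subseteq> {0, 1} \<and> length x = m}"

text \<open>Padding with one extra symbol would make all these lists have length exactly
  \<open>K\<close>; the proof checks the resulting bound on the geometric sum.\<close>

lemma card_lists_le:
  assumes "finite A"
  shows "card {l. set l \<subseteq> A \<and> length l \<le> K} \<le> (card A + 1) ^ K"
proof -
  have "(\<Sum>i \<le> K. card A ^ i) \<le> (card A + 1) ^ K"
  proof (induction K)
    case (Suc K)
    have "card A ^ K \<le> (card A + 1) ^ K" by (rule power_mono) auto
    then have "card A * card A ^ K \<le> card A * (card A + 1) ^ K" by (rule mult_le_mono2)
    then have "(\<Sum>i \<le> K. card A ^ i) + card A * card A ^ K \<le> (card A + 1) ^ K + card A * (card A + 1) ^ K"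
      using Suc.IH by linarith
    then show ?case by simp
  qed simp
  then show ?thesis by (simp add: card_lists_length_le[OF assms])
qed

section \<open>Response times of the simulator and its configurations at these times\<close>

locale simulation =
  fixes Q M :: machine and k :: nat
  assumes Q: "is_machine Q" and M: "is_machine M" and serves: "serves M"
    and queues: "storage Q = replicate k empty_queue"
    and sim: "simulates_online Q M"
begin

text \<open>The extra command 0 keeps \<open>Q\<close> from seeing the end of the input. Being
  online, \<open>Q\<close> answers \<open>z\<close> before reading it, so the run up to this moment
  does not depend on what follows \<open>z\<close>.\<close>

definition time :: "nat list \<Rightarrow> nat" where
  "time z = (LEAST s. prefix (answers z []) (produced Q (z @ [0]) s))"

definition state :: "nat list \<Rightarrow> nat" where
  "state z = fst (run Q z (time z))"

definition devices :: "nat list \<Rightarrow> store list" where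
  "devices z = fst (snd (snd (run Q z (time z))))"

abbreviation queue :: "nat list \<Rightarrow> nat \<Rightarrow> nat list" where
  "queue z i \<equiv> content (devices z ! i)"

lemma inputs_M: "inputs M = commands"
  using serves by (simp add: serves_def)

lemma time_witness:
  assumes z: "z \<in> lists commands"
  shows "\<exists>s. consumed Q (z @ [0]) s \<le> length z \<and> prefix (answers z []) (produced Q (z @ [0]) s)"
proof -
  obtain t where t: "produced M (z @ [0]) t = answers z []" "consumed M (z @ [0]) t \<le> length z"
    using serves z unfolding serves_def by blast
  have "z @ [0] \<in> lists (inputs M)" using z by (simp add: inputs_M)
  with sim t show ?thesis unfolding simulates_online_def by (metis le_trans)
qed

text \<open>
  As every command is answered, \<open>Q\<close> cannot have answered \<open>z\<close> without having read all of it: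
  otherwise it would answer too much on a shorter input.
\<close>

lemma run_time:
  assumes z: "z \<in> lists commands"
  shows "run Q (z @ u) (time z) = (state z, u, devices z, answers z [])"
proof -
  let ?P = "\<lambda>s. prefix (answers z []) (produced Q (z @ [0]) s)"
  obtain s where s: "consumed Q (z @ [0]) s \<le> length z" "?P s" using time_witness[OF z] by blast
  have P: "?P (time z)" unfolding time_def by (rule LeastI, rule s(2))
  have "time z \<le> s" unfolding time_def by (rule Least_le, rule s(2))
  then have c: "consumed Q (z @ [0]) (time z) \<le> length z" using consumed_mono s(1) le_trans by blast
  obtain q xs ss out where r: "run Q (z @ [0]) (time z) = (q, xs, ss, out)" by (metis prod_cases4)
  have "length [0 :: nat] \<le> length xs" using c r by (simp add: consumed_def)
  from run_prefix[OF r _ this] obtain z' where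
    z': "xs = z' @ [0]" "\<And>v. run Q (z @ v) (time z) = (q, z' @ v, ss, out)" by auto
  \<comment> \<open>\<open>z0\<close> is the part of \<open>z\<close> read so far and
    \<open>z'\<close> the unread rest. Cutting the input off after \<open>z0\<close> goes unnoticed
    by \<open>Q\<close> up to this moment.\<close>
  obtain z0 where z0: "z = z0 @ z'" using run_suffix[OF r] z'(1) by (auto simp: suffix_def)
  have "run Q (z0 @ (z' @ [0])) (time z) = (q, z' @ [0], ss, out)" using r z'(1) z0 by simp
  from run_prefix[OF this, of "[]"] have "run Q z0 (time z) = (q, [], ss, out)" by simp
  then have out: "produced Q z0 (time z) = out" by (simp add: produced_def)
  have "z0 \<in> lists commands" using z z0 by auto
  then have "prefix out (answers z0 [])"
    using sim serves out unfolding simulates_online_def same_output_def serves_def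
    by (metis prefix_order.trans)
  moreover have "prefix (answers z []) out" using P r by (simp add: produced_def)
  ultimately have "prefix (answers z []) (answers z0 [])" "prefix out (answers z0 [])"
    by (auto intro: prefix_order.trans)
  then have "z' = []" using prefix_length_le z0 by fastforce
  with z0 \<open>prefix out (answers z0 [])\<close> \<open>prefix (answers z []) out\<close> have "out = answers z []"
    by (simp add: prefix_order.antisym)
  then show ?thesis using z'(2) \<open>z' = []\<close> z'(2)[of "[]"] by (simp add: state_def devices_def)
qed

lemma time_le:
  assumes z: "z \<in> lists commands" and s: "prefix (answers z []) (produced Q (z @ [0]) s)"
  shows "time z \<le> s"
  unfolding time_def by (rule Least_le, rule s)

text \<open>Up to \<open>time z\<close> nothing beyond \<open>z\<close> has been read. If all
  commands, including those of \<open>y\<close>, were answered earlier, then so would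
  \<open>z\<close> be when followed by 0, against the minimality of \<open>time z\<close>.\<close>

lemma time_mono:
  assumes z: "z \<in> lists commands" and y: "y \<in> lists commands"
  shows "time z \<le> time (z @ y)"
proof (rule ccontr)
  let ?s = "time (z @ y)"
  assume neg: "\<not> time z \<le> ?s"
  obtain q xs ss out where r: "run Q (z @ [0]) ?s = (q, xs, ss, out)" by (metis prod_cases4)
  have "consumed Q (z @ [0]) ?s \<le> consumed Q (z @ [0]) (time z)" by (rule consumed_mono) (use neg in simp)
  also have "\<dots> = length z" by (simp add: consumed_def run_time[OF z])
  finally have "length [0 :: nat] \<le> length xs" using r by (simp add: consumed_def)
  from run_prefix[OF r _ this, of "y @ [0]"] obtain z' where
    "run Q (z @ y @ [0]) ?s = (q, z' @ y @ [0], ss, out)" by auto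
  moreover have "run Q ((z @ y) @ [0]) ?s = (state (z @ y), [0], devices (z @ y), answers (z @ y) [])"
    by (rule run_time) (use z y in simp)
  ultimately have "out = answers (z @ y) []" by simp
  then have "prefix (answers z []) (produced Q (z @ [0]) ?s)"
    using r by (simp add: produced_def answers_append)
  from time_le[OF z this] neg show False by simp
qed

text \<open>The server needs at most two steps per command, so its first \<open>n\<close> steps
  answer all of \<open>z\<close>, and \<open>Q\<close> has to reproduce these answers.\<close>

lemma time_le_sim_time:
  assumes z: "z \<in> lists commands" and n: "2 * length z \<le> n"
  shows "time z \<le> sim_time Q M n"
proof -
  let ?x = "z @ [0]"
  have x: "?x \<in> lists (inputs M)" using z by (simp add: inputs_M)
  obtain t where t: "t \<le> 2 * length z" "produced M ?x t = answers z []"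
    using serves z unfolding serves_def by blast
  have "prefix (produced M ?x t) (produced M ?x n)" by (rule produced_mono) (use t n in simp)
  moreover have "prefix (produced M ?x n) (produced Q ?x (sim_steps Q M n ?x))"
    unfolding sim_steps_def
    by (rule LeastI_ex) (use sim x in \<open>auto simp: simulates_online_def same_output_def\<close>)
  ultimately have "prefix (answers z []) (produced Q ?x (sim_steps Q M n ?x))"
    using t(2) by (metis prefix_order.trans)
  then have "time z \<le> sim_steps Q M n ?x" by (rule time_le[OF z])
  also have "\<dots> \<le> sim_time Q M n"
    unfolding sim_time_def by (rule Max_ge) (use finite_sim_steps[OF M sim] x in auto)
  finally show ?thesis .
qed

lemma well_formed_time:
  assumes z: "z \<in> lists commands" and u: "u \<in> lists commands"
  shows "well_formed Q (state z, u, devices z, answers z [])"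
proof -
  have "inputs M \<subseteq> inputs Q" using sim by (simp add: simulates_online_def)
  then have "set (z @ u) \<subseteq> inputs Q" using z u inputs_M by auto
  then have "well_formed Q (start Q, z @ u, storage Q, [])"
    using Q queues by (auto simp: well_formed_def is_machine_def empty_queue_def)
  from steps_queues[OF Q this] run_time[OF z, of u] show ?thesis by (simp add: run_def)
qed

lemma
  assumes z: "z \<in> lists commands"
  shows state_time: "state z \<in> states Q"
    and length_devices: "length (devices z) = k"
    and queue_time: "i < k \<Longrightarrow> devices z ! i = Queue (queue z i) \<and> set (queue z i) \<subseteq> symbols Q"
  using well_formed_time[OF z, of "[]"] queues by (auto simp: well_formed_def queue_over_content)

lemma run_extend:
  assumes z: "z \<in> lists commands"
  shows "run Q (z @ u) (time z + t) = (step Q ^^ t) (state z, u, devices z, answers z [])"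
  by (simp add: run_add run_time[OF z])

section \<open>Distinguishing pushed words by counting codes\<close>

lemma queue_evolution:
  assumes z: "z \<in> lists commands" and y: "y \<in> lists commands" and i: "i < k"
  shows "\<exists>p \<le> time (z @ y) - time z. \<exists>v. queue (z @ y) i = drop p (queue z i) @ v"
proof -
  have "(step Q ^^ (time (z @ y) - time z)) (state z, y, devices z, answers z []) =
      run Q (z @ y) (time (z @ y))"
    using run_extend[OF z, of y "time (z @ y) - time z"] time_mono[OF z y] by simp
  also have "\<dots> = (state (z @ y), [], devices (z @ y), answers (z @ y) [])"
    using run_time[of "z @ y" "[]"] z y by simp
  finally show ?thesis
    using steps_queues[OF Q well_formed_time[OF z y]] i queues by auto
qed

text \<open>While the queues look alike, both runs emit the same word \<open>w\<close>. At the
  earlier of the two finishing times one run has answered all of \<open>y\<close>, so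
  \<open>w\<close> is as long as \<open>y\<close> and, being a prefix of both answers, equals
  both.\<close>

lemma alike_answers:
  assumes z: "z \<in> lists commands" "z' \<in> lists commands" and y: "y \<in> lists commands"
    and st: "state z = state z'"
    and al: "list_all2 (alike N) (devices z) (devices z')"
    and fast: "time (z @ y) \<le> time z + N" "time (z' @ y) \<le> time z' + N"
  shows "answers y (after z []) = answers y (after z' [])"
proof -
  define a where "a = time (z @ y) - time z"
  define a' where "a' = time (z' @ y) - time z'"
  define b where "b = min a a'"
  have ta: "time (z @ y) = time z + a" "time (z' @ y) = time z' + a'"
    using time_mono z y by (simp_all add: a_def a'_def)
  have 1: "produced Q (v @ y) (time v + c) = answers v [] @ answers y (after v [])"
    if "v \<in> lists commands" "time (v @ y) = time v + c" for v c
    using run_time[of "v @ y" "[]"] that y by (simp add: produced_def answers_append)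
  have "b \<le> N" using fast ta by (simp add: b_def)
  from steps_alike[OF al this, of Q "state z" y "answers z []" "answers z' []"]
  obtain w where w: "produced Q (z @ y) (time z + b) = answers z [] @ w"
    "produced Q (z' @ y) (time z' + b) = answers z' [] @ w"
    using run_extend[OF z(1), of y b] run_extend[OF z(2), of y b] st
    by (auto simp: produced_def)
  have "prefix (answers z [] @ w) (answers z [] @ answers y (after z []))"
    using produced_mono[of "time z + b" "time z + a" Q "z @ y"] w(1) 1[OF z(1) ta(1)]
    by (simp add: b_def)
  then have p: "prefix w (answers y (after z []))" by simp
  have "prefix (answers z' [] @ w) (answers z' [] @ answers y (after z' []))"
    using produced_mono[of "time z' + b" "time z' + a'" Q "z' @ y"] w(2) 1[OF z(2) ta(2)]
    by (simp add: b_def)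
  then have p': "prefix w (answers y (after z' []))" by simp
  have "w = answers y (after z []) \<or> w = answers y (after z' [])"
    using w 1[OF z(1) ta(1)] 1[OF z(2) ta(2)] by (auto simp: b_def min_def split: if_splits)
  then have "length w = length y" by auto
  then have "w = answers y (after z [])" "w = answers y (after z' [])"
    using p p' by (metis append_Nil2 append_eq_append_conv length_answers prefix_def)+
  then show ?thesis by simp
qed

text \<open>
  The word pushed is determined by what is known of \<open>Q\<close> just before the pops: its state, the
  contents of the short queues, and for each long queue the number of old symbols popped.
\<close>

lemma window:
  fixes u :: "nat list \<Rightarrow> nat list"
  assumes z: "z \<in> lists commands"
    and u: "\<And>x. x \<in> words m \<Longrightarrow> u x \<in> lists commands \<and> neutral (u x)"
    and fast: "\<And>x. x \<in> words m \<Longrightarrow> time (z @ x @ u x @ replicate m 2) < time z + L"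
    and small: "\<And>x i. x \<in> words m \<Longrightarrow> i < k \<Longrightarrow>
                  2 * L \<le> length (queue z i) \<or> length (queue (z @ x @ u x) i) \<le> K"
  shows "2 ^ m \<le> card (states Q) * ((L + 1) * (card (symbols Q) + 1) ^ K) ^ k"
proof -
  define c where "c = (\<lambda>x. z @ x @ u x)"
  have x_cmd: "x \<in> lists commands" if "x \<in> words m" for x
    using that by (auto simp: words_def)
  have c: "c x \<in> lists commands" if "x \<in> words m" for x
    using that z u[OF that] x_cmd[OF that] by (auto simp: c_def)
  have pops: "replicate m 2 \<in> lists commands" by auto
  have total: "time (c x @ replicate m 2) < time z + L" if "x \<in> words m" for x
    using fast[OF that] by (simp add: c_def)
  have elapsed: "time z \<le> time (c x) \<and> time (c x) < time z + L" if x: "x \<in> words m" for x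
    using time_mono[OF z, of "x @ u x"] time_mono[OF c[OF x] pops] total[OF x] u[OF x] x_cmd[OF x]
    by (auto simp: c_def)
  have ev: "\<exists>p. p \<le> L \<and> (\<exists>v. queue (c x) i = drop p (queue z i) @ v)"
    if x: "x \<in> words m" and i: "i < k" for x i
  proof -
    have "x @ u x \<in> lists commands" using u[OF x] x_cmd[OF x] by simp
    from queue_evolution[OF z this i] obtain q v
      where "q \<le> time (c x) - time z" "queue (c x) i = drop q (queue z i) @ v"
      unfolding c_def by blast
    moreover have "time (c x) - time z \<le> L" using elapsed[OF x] by linarith
    ultimately show ?thesis using le_trans by blast
  qed
  \<comment> \<open>Several values may be admissible; any fixed choice serves, as it only has to
    determine the old symbols at the front.\<close>
  define p where "p = (\<lambda>x i. SOME p. p \<le> L \<and> (\<exists>v. queue (c x) i = drop p (queue z i) @ v))"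
  have p: "p x i \<le> L \<and> (\<exists>v. queue (c x) i = drop (p x i) (queue z i) @ v)"
    if "x \<in> words m" "i < k" for x i
    unfolding p_def by (rule someI_ex, rule ev[OF that])
  define big where "big = (\<lambda>i. 2 * L \<le> length (queue z i))"
  \<comment> \<open>Each queue fills one of the two components and puts a dummy into the other, so
    that all items lie in a single finite product.\<close>
  define item where "item = (\<lambda>x i. if big i then (p x i, []) else (0, queue (c x) i))"
  define code where "code = (\<lambda>x. (state (c x), map (item x) [0..<k]))"
  define codes where "codes = states Q \<times> {ds. set ds \<subseteq> {..L} \<times> {l. set l \<subseteq> symbols Q \<and> length l \<le> K} \<and>
    length ds = k}"
  have "code x \<in> codes" if x: "x \<in> words m" for x
  proof -
    have "item x i \<in> {..L} \<times> {l. set l \<subseteq> symbols Q \<and> length l \<le> K}" if i: "i < k" for i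
      using p[OF x i] queue_time[OF c[OF x] i] small[OF x i] by (auto simp: item_def big_def c_def)
    then show ?thesis
      using state_time[OF c[OF x]] unfolding code_def codes_def by (simp add: image_subset_iff)
  qed
  then have sub: "code ` words m \<subseteq> codes" by blast
  have fin: "finite (states Q)" "finite (symbols Q)" using Q by (auto simp: is_machine_def)
  then have "finite codes"
    unfolding codes_def
    by (intro finite_cartesian_product finite_lists_length_eq finite_lists_length_le) auto
  have "inj_on code (words m)"
  proof (rule inj_onI)
    fix x y assume x: "x \<in> words m" and y: "y \<in> words m" and eq: "code x = code y"
    have st: "state (c x) = state (c y)" using eq by (simp add: code_def)
    have each: "if big i then p x i = p y i else queue (c x) i = queue (c y) i" if "i < k" for i
      using eq that by (auto simp: code_def item_def map_eq_conv split: if_splits)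
    have "alike L (devices (c x) ! i) (devices (c y) ! i)" if i: "i < k" for i
    proof (cases "big i")
      case True
      obtain v w where "queue (c x) i = drop (p x i) (queue z i) @ v"
        "queue (c y) i = drop (p x i) (queue z i) @ w"
        using p[OF x i] p[OF y i] each[OF i] True by auto
      \<comment> \<open>At most \<open>L\<close> of at least \<open>2 * L\<close> old symbols are
        gone. The remaining ones hide the newer part of the queue during the pops, which take fewer
        than \<open>L\<close> steps.\<close>
      moreover have "L \<le> length (drop (p x i) (queue z i))"
        using True p[OF x i] unfolding big_def length_drop by linarith
      ultimately show ?thesis
        using queue_time[OF c[OF x] i] queue_time[OF c[OF y] i] by (auto simp: alike_def)
    next
      case False
      with each[OF i] queue_time[OF c[OF x] i] queue_time[OF c[OF y] i] show ?thesis
        by (auto simp: alike_def)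
    qed
    then have "list_all2 (alike L) (devices (c x)) (devices (c y))"
      using length_devices[OF c[OF x]] length_devices[OF c[OF y]]
      by (simp add: list_all2_conv_all_nth)
    from alike_answers[OF c[OF x] c[OF y] pops st this]
    have "answers (replicate m 2) (after (c x) []) = answers (replicate m 2) (after (c y) [])"
      using total[OF x] total[OF y] elapsed[OF x] elapsed[OF y] by simp
    \<comment> \<open>As \<open>u v\<close> restores the store, the pops return \<open>v\<close> in
      reverse.\<close>
    moreover have "answers (replicate m 2) (after (c v) []) = rev v" if v: "v \<in> words m" for v
    proof -
      have "after (c v) [] = rev v @ after z []"
        using u[OF v] v by (simp add: c_def after_append after_bits neutral_def words_def)
      then show ?thesis using v answers_pops[of "rev v"] by (simp add: words_def)
    qed
    ultimately show "x = y" using x y by simp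
  qed
  then have "card (words m) \<le> card codes"
    using sub \<open>finite codes\<close> by (rule card_inj_on_le)
  moreover have "card (words m) = 2 ^ m"
    by (simp add: words_def card_lists_length_eq numeral_2_eq_2)
  moreover have "card codes \<le> card (states Q) * ((L + 1) * (card (symbols Q) + 1) ^ K) ^ k"
    using fin card_lists_le[OF fin(2), of K]
    by (simp add: codes_def card_cartesian_product card_lists_length_eq finite_lists_length_le
        power_mono mult_le_mono2 del: power_mult_distrib mult_Suc)
  ultimately show ?thesis by simp
qed

text \<open>
  The adversary repeats costly windows of the next lower level until too few queues are long for
  another one, and then pops.
\<close>

lemma costly_window:
  fixes C r l :: nat
  assumes r: "2 \<le> r"
    and count: "\<And>j. j \<le> k \<Longrightarrow>
      card (states Q) * ((r ^ Suc j * l + 1) * (card (symbols Q) + 1) ^ (2 * (r ^ j * l))) ^ k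
        < 2 ^ (C * (r ^ j * l))"
    and z: "z \<in> lists commands" and j: "j \<le> k"
    and long: "k - j \<le> card {i. i < k \<and> 2 * (r ^ Suc j * l) \<le> length (queue z i)}"
  shows "\<exists>w \<in> lists commands. neutral w \<and> length w \<le> 2 * C * Suc j * (r ^ j * l) \<and>
           time z + r ^ Suc j * l \<le> time (z @ w)"
  using z j long
proof (induction j arbitrary: z)
  case (0 z)
  let ?m = "C * (r ^ 0 * l)"
  let ?L = "r ^ Suc 0 * l"
  show ?case
  proof (rule ccontr)
    assume "\<not> ?case"
    then have neg: "time (z @ w) < time z + ?L"
      if "w \<in> lists commands" "neutral w" "length w \<le> 2 * C * Suc 0 * (r ^ 0 * l)" for w
      using that by (meson not_le)
    \<comment> \<open>At level 0 all queues are long, so every queue falls under the first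
      alternative in \<open>window\<close>.\<close>
    have "{i. i < k \<and> 2 * ?L \<le> length (queue z i)} = {..<k}"
      by (rule card_seteq) (use 0 in auto)
    then have all: "2 * ?L \<le> length (queue z i)" if "i < k" for i using that by blast
    have "time (z @ x @ [] @ replicate ?m 2) < time z + ?L" if "x \<in> words ?m" for x
    proof (rule neg)
      show "x @ [] @ replicate ?m 2 \<in> lists commands" using that by (auto simp: words_def)
      show "neutral (x @ [] @ replicate ?m 2)"
        using neutral_window[of x "[]"] that by (simp add: words_def neutral_Nil)
      show "length (x @ [] @ replicate ?m 2) \<le> 2 * C * Suc 0 * (r ^ 0 * l)"
        using that by (simp add: words_def)
    qed
    with window[OF "0.prems"(1), of ?m "\<lambda>_. []" ?L "2 * (r ^ 0 * l)"] all count[of 0]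
    show False by (simp add: neutral_Nil)
  qed
next
  case (Suc j z)
  note IH = Suc.IH
  let ?m = "C * (r ^ Suc j * l)"
  let ?A = "2 * C * Suc j * (r ^ j * l)"
  let ?K = "r ^ Suc j * l"
  let ?L = "r ^ Suc (Suc j) * l"
  let ?pops = "replicate ?m (2 :: nat)"
  define long where "long = (\<lambda>K v. {i. i < k \<and> 2 * K \<le> length (queue v i)})"
  have L: "?L = r * ?K" by simp
  show ?case
  proof (rule ccontr)
    assume "\<not> ?case"
    then have neg: "time (z @ w) < time z + ?L"
      if "w \<in> lists commands" "neutral w" "length w \<le> 2 * C * Suc (Suc j) * (r ^ Suc j * l)" for w
      using that by (meson not_le)
    have fast: "time (z @ x @ u @ ?pops) < time z + ?L"
      if "x \<in> words ?m" "u \<in> lists commands" "neutral u" "length u \<le> r * ?A" for x u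
    proof (rule neg)
      show "x @ u @ ?pops \<in> lists commands" using that by (auto simp: words_def)
      show "neutral (x @ u @ ?pops)"
        using neutral_window[of x u] that by (simp add: words_def)
      \<comment> \<open>In units of \<open>r ^ Suc j * l\<close>, the word and its pops contribute
        \<open>2 * C\<close> and the inner windows at most \<open>2 * C * Suc j\<close>.\<close>
      show "length (x @ u @ ?pops) \<le> 2 * C * Suc (Suc j) * (r ^ Suc j * l)"
        using that by (simp add: words_def algebra_simps)
    qed
    \<comment> \<open>A suitable \<open>u\<close> leaves short every queue that was not long at
      \<open>z\<close>, as \<open>window\<close> demands; otherwise inner windows could go on until
      the time \<open>?L\<close> is used up.\<close>
    have "\<exists>u. u \<in> lists commands \<and> neutral u \<and> length u \<le> r * ?A \<and>
        (\<forall>i < k. 2 * ?L \<le> length (queue z i) \<or> length (queue (z @ x @ u) i) \<le> 2 * ?K)"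
      if x: "x \<in> words ?m" for x
    proof (rule ccontr)
      assume no: "\<not> ?thesis"
      have x': "x \<in> lists commands" using x by (auto simp: words_def)
      have elapsed: "time (z @ x @ u) < time z + ?L"
        if u: "u \<in> lists commands" "neutral u" "length u \<le> r * ?A" for u
      proof -
        have "time ((z @ x @ u)) \<le> time ((z @ x @ u) @ ?pops)"
          by (rule time_mono) (use Suc.prems(1) x' u in auto)
        with fast[OF x u] show ?thesis by simp
      qed
      have many: "k - j \<le> card (long ?K (z @ x @ u))"
        if u: "u \<in> lists commands" "neutral u" "length u \<le> r * ?A" for u
      proof (rule ccontr)
        assume few: "\<not> ?thesis"
        \<comment> \<open>Queues long at \<open>z\<close> lose at most \<open>?L\<close> symbols and
          stay long at the lower level, since \<open>r\<close> is at least 2. Without an additional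
          long queue, \<open>u\<close> would be as demanded.\<close>
        have "long ?L z \<subseteq> long ?K (z @ x @ u)"
        proof
          fix i assume "i \<in> long ?L z"
          then have i: "i < k" "2 * ?L \<le> length (queue z i)" by (auto simp: long_def)
          obtain p v where p: "p \<le> time (z @ x @ u) - time z"
            "queue (z @ x @ u) i = drop p (queue z i) @ v"
            using queue_evolution[OF Suc.prems(1) _ i(1), of "x @ u"] x' u by auto
          have "p \<le> ?L" using p(1) elapsed[OF u] by linarith
          then have "?L \<le> length (queue (z @ x @ u) i)" using p(2) i(2) by simp
          moreover have "2 * ?K \<le> ?L" unfolding L using r by (rule mult_le_mono1)
          ultimately have "2 * ?K \<le> length (queue (z @ x @ u) i)" using le_trans by blast
          then show "i \<in> long ?K (z @ x @ u)" using i(1) by (simp only: long_def mem_Collect_eq)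
        qed
        moreover have "card (long ?K (z @ x @ u)) \<le> card (long ?L z)"
          using few Suc.prems(3) by (simp add: long_def)
        ultimately have "long ?L z = long ?K (z @ x @ u)"
          by (intro card_seteq) (auto simp: long_def)
        then have "2 * ?L \<le> length (queue z i) \<or> length (queue (z @ x @ u) i) \<le> 2 * ?K"
          if "i < k" for i
          using that unfolding long_def set_eq_iff mem_Collect_eq by (meson nat_le_linear)
        with no u show False by blast
      qed
      \<comment> \<open>By \<open>many\<close>, there are always enough long queues for another
        window of level \<open>j\<close>, so \<open>a\<close> of them can be chained at a cost of at
        least \<open>?K\<close> each.\<close>
      have "\<exists>u. u \<in> lists commands \<and> neutral u \<and> length u \<le> a * ?A \<and>
          time (z @ x) + a * ?K \<le> time (z @ x @ u)" if "a \<le> r" for a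
        using that
      proof (induction a)
        case 0
        show ?case by (rule exI[of _ "[]"]) (simp add: neutral_Nil)
      next
        case (Suc a)
        then obtain u where u: "u \<in> lists commands" "neutral u" "length u \<le> a * ?A"
          "time (z @ x) + a * ?K \<le> time (z @ x @ u)" by auto
        have "a * ?A \<le> r * ?A" by (rule mult_le_mono1) (use Suc.prems in simp)
        then have "length u \<le> r * ?A" using u(3) le_trans by blast
        from many[OF u(1,2) this] obtain w where w: "w \<in> lists commands" "neutral w"
          "length w \<le> ?A" "time (z @ x @ u) + ?K \<le> time ((z @ x @ u) @ w)"
          using IH[of "z @ x @ u"] \<open>Suc j \<le> k\<close> \<open>z \<in> lists commands\<close> x' u(1)
          by (auto simp: long_def)
        show ?case
          using u w by (intro exI[of _ "u @ w"]) (auto simp: neutral_append)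
      qed
      then obtain u where u: "u \<in> lists commands" "neutral u" "length u \<le> r * ?A"
        "time (z @ x) + r * ?K \<le> time (z @ x @ u)" by blast
      have "time z \<le> time (z @ x)" by (rule time_mono) (use Suc.prems(1) x' in auto)
      with u(4) elapsed[OF u(1-3)] show False unfolding L by linarith
    qed
    then obtain u where u: "\<And>x. x \<in> words ?m \<Longrightarrow> u x \<in> lists commands \<and> neutral (u x) \<and>
        length (u x) \<le> r * ?A \<and>
        (\<forall>i < k. 2 * ?L \<le> length (queue z i) \<or> length (queue (z @ x @ u x) i) \<le> 2 * ?K)"
      by metis
    have "2 ^ ?m \<le> card (states Q) * ((?L + 1) * (card (symbols Q) + 1) ^ (2 * ?K)) ^ k"
      by (rule window[OF Suc.prems(1), where u = u]) (use u fast in \<open>blast+\<close>)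
    with count[OF Suc.prems(2)] show False by simp
  qed
qed

section \<open>Choice of the parameters and the asymptotic bound\<close>

lemma sim_time_ge:
  fixes C r l n :: nat
  assumes "2 \<le> r"
    and "\<And>j. j \<le> k \<Longrightarrow>
      card (states Q) * ((r ^ Suc j * l + 1) * (card (symbols Q) + 1) ^ (2 * (r ^ j * l))) ^ k
        < 2 ^ (C * (r ^ j * l))"
    and n: "4 * C * Suc k * (r ^ k * l) \<le> n"
  shows "r ^ Suc k * l \<le> sim_time Q M n"
proof -
  \<comment> \<open>The top level requires no long queue, so the window can start at once. Its
    length is doubled below because the server spends up to two steps per command.\<close>
  obtain w where w: "w \<in> lists commands" "length w \<le> 2 * C * Suc k * (r ^ k * l)"
    "time [] + r ^ Suc k * l \<le> time ([] @ w)"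
    using costly_window[OF assms(1,2), of "[]" k] by auto
  have "2 * (2 * C * Suc k * (r ^ k * l)) = 4 * C * Suc k * (r ^ k * l)" by (simp add: algebra_simps)
  then have "2 * length w \<le> n" using w(2) n by linarith
  from time_le_sim_time[OF w(1) this] w(3) show ?thesis by simp
qed

text \<open>Every factor is bounded by a power of 2 whose exponent is linear in
  \<open>r ^ j * l\<close>; for the time factor this holds because \<open>l\<close> is at most
  \<open>r ^ j * l\<close>. The final \<open>+ 1\<close> in the exponent makes the inequality
  strict.\<close>

lemma code_count:
  fixes s g r l j :: nat
  assumes s: "card (states Q) \<le> 2 ^ s" and g: "card (symbols Q) + 1 \<le> 2 ^ g"
    and r: "1 \<le> r" and l: "1 \<le> l" and time: "r ^ Suc k * l + 1 \<le> 2 ^ (3 * l)" and j: "j \<le> k"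
  shows "card (states Q) * ((r ^ Suc j * l + 1) * (card (symbols Q) + 1) ^ (2 * (r ^ j * l))) ^ k
           < 2 ^ ((s + 3 * k + 2 * g * k + 1) * (r ^ j * l))"
proof -
  define X where "X = r ^ j * l"
  have X: "1 \<le> X" "l \<le> X" using r l by (simp_all add: X_def)
  have "r ^ Suc j \<le> r ^ Suc k" by (rule power_increasing) (use r j in auto)
  then have "r ^ Suc j * l + 1 \<le> r ^ Suc k * l + 1" by (intro add_le_mono1 mult_le_mono1)
  then have 1: "r ^ Suc j * l + 1 \<le> 2 ^ (3 * l)" using time le_trans by blast
  have 2: "(card (symbols Q) + 1) ^ (2 * X) \<le> (2 ^ g) ^ (2 * X)"
    by (rule power_mono[OF g]) simp
  have "card (states Q) * ((r ^ Suc j * l + 1) * (card (symbols Q) + 1) ^ (2 * X)) ^ k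
      \<le> 2 ^ s * (2 ^ (3 * l) * (2 ^ g) ^ (2 * X)) ^ k"
    by (intro mult_le_mono s power_mono 1 2) simp
  also have "\<dots> = 2 ^ (s + 3 * k * l + 2 * g * k * X)"
    by (simp add: power_add power_mult_distrib flip: power_mult) (simp add: algebra_simps)
  also have "\<dots> < 2 ^ ((s + 3 * k + 2 * g * k + 1) * X)"
  proof (rule power_strict_increasing)
    have "s \<le> s * X" "3 * k * l \<le> 3 * k * X" using X by simp_all
    then have "s + 3 * k * l + 2 * g * k * X < s * X + 3 * k * X + 2 * g * k * X + X"
      using X by linarith
    then show "s + 3 * k * l + 2 * g * k * X < (s + 3 * k + 2 * g * k + 1) * X"
      by (simp add: algebra_simps)
  qed simp
  finally show ?thesis by (simp only: X_def)
qed

text \<open>With \<open>l\<close> of order \<open>log n\<close> and \<open>r\<close> of order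
  \<open>(n / log n) powr (1 / k)\<close>, a window of level \<open>k\<close> fits into
  \<open>n\<close> steps, and its cost \<open>r ^ Suc k * l\<close> has the order claimed.\<close>

lemma sim_time_bigomega:
  assumes k: "1 \<le> k"
  shows "(\<lambda>n. real (sim_time Q M n))
           \<in> \<Omega>(\<lambda>n. real n powr (1 + 1 / real k) / ln (real n) powr (1 / real k))"
proof -
  obtain s g :: nat where sg: "card (states Q) \<le> 2 ^ s" "card (symbols Q) + 1 \<le> 2 ^ g"
    by (meson less_exp less_imp_le)
  define C where "C = s + 3 * k + 2 * g * k + 1"
  \<comment> \<open>The factor 12 combines the 4 in \<open>sim_time_ge\<close> with the 3 in
    \<open>l \<le> 3 * ln n\<close>.\<close>
  define E where "E = 12 * real C * real (Suc k)"
  define \<rho> where "\<rho> = (\<lambda>n. (real n / (E * ln (real n))) powr (1 / real k))"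
  \<comment> \<open>The power of 2 pays for rounding \<rho> down to \<open>r\<close>; the powers of
    \<open>E\<close> come from \<rho> itself.\<close>
  define b where "b = 1 / (2 ^ Suc k * E * E powr (1 / real k))"
  have C: "C \<ge> 1" by (simp add: C_def)
  then have "1 * 1 \<le> real C * real (Suc k)" by (intro mult_mono) auto
  then have E: "E \<ge> 12" unfolding E_def by linarith
  have root: "(x powr (1 / real k)) ^ k = x" if "0 < x" for x :: real
    using that k by (simp add: powr_power)
  \<comment> \<open>This makes \<rho> at least 3 eventually, so that \<open>r\<close> is at least 2
    and at least half of \<rho>.\<close>
  have "filterlim (\<lambda>n::nat. real n / ln (real n)) at_top sequentially" by real_asymp
  then have "\<forall>\<^sub>F n in sequentially. 3 ^ k * E \<le> real n / ln (real n)"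
    by (simp add: filterlim_at_top)
  moreover have "\<forall>\<^sub>F n in sequentially. (3::nat) \<le> n" by (rule eventually_ge_at_top)
  ultimately have "\<forall>\<^sub>F n in sequentially.
      b * norm (real n powr (1 + 1 / real k) / ln (real n) powr (1 / real k))
        \<le> norm (real (sim_time Q M n))"
  proof eventually_elim
    case (elim n)
    define l where "l = nat \<lceil>log 2 (real n)\<rceil>"
    define r where "r = nat \<lfloor>\<rho> n\<rfloor>"
    have "ln 3 \<le> ln (real n)" using elim(2) by simp
    moreover have "1 \<le> ln (3 :: real)"
      using exp_le by (subst ln_ge_iff) auto
    ultimately have ln: "1 \<le> ln (real n)" by linarith
    have ln2: "1 / 2 \<le> ln (2 :: real)" "ln (2 :: real) \<le> 1"
      using ln_ge_iff[THEN iffD2, OF _ exp_half_le2] ln_2_less_1 by auto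
    have "ln (real n) * ln 2 \<le> ln (real n) * 1" "ln (real n) * (1 / 2) \<le> ln (real n) * ln 2"
      using ln ln2 by (intro mult_left_mono; simp)+
    then have "ln (real n) \<le> log 2 (real n)" "log 2 (real n) \<le> 2 * ln (real n)"
      using ln2 by (simp_all add: log_def field_simps)
    moreover have "log 2 (real n) \<le> real l" "real l \<le> log 2 (real n) + 1"
      using calculation ln by (simp_all add: l_def)
    ultimately have l: "ln (real n) \<le> real l" "real l \<le> 3 * ln (real n)" "log 2 (real n) \<le> real l"
      using ln by linarith+
    have l1: "1 \<le> l" using l ln by linarith
    let ?x = "real n / (E * ln (real n))"
    have x: "3 ^ k \<le> ?x"
      using elim(1) E ln by (simp add: field_simps)
    then have x0: "0 < ?x" by (smt (verit) zero_less_power)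
    have \<rho>k: "\<rho> n ^ k = ?x"
      unfolding \<rho>_def by (rule root[OF x0])
    have "0 \<le> \<rho> n" by (simp add: \<rho>_def)
    then have \<rho>3: "3 \<le> \<rho> n"
      using x \<rho>k k power_mono_iff[of 3 "\<rho> n" k] by simp
    have r: "real r \<le> \<rho> n" "\<rho> n / 2 \<le> real r" "3 \<le> r"
      using \<rho>3 by (auto simp: r_def le_nat_iff le_floor_iff) linarith+
    have "real r ^ k \<le> ?x" unfolding \<rho>k[symmetric] by (rule power_mono[OF r(1)]) simp
    then have "real r ^ k * real l \<le> ?x * (3 * ln (real n))"
      using l(2) x0 by (intro mult_mono) auto
    also have "\<dots> = 3 * real n / E" using ln by simp
    finally have "E * (real r ^ k * real l) \<le> 3 * real n" using E by (simp add: field_simps)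
    then have "real (4 * C * Suc k * (r ^ k * l)) \<le> real n"
      unfolding E_def by (simp add: algebra_simps)
    then have n: "4 * C * Suc k * (r ^ k * l) \<le> n" by (simp only: of_nat_le_iff)
    have "1 * (r ^ k * l) \<le> 4 * C * Suc k * (r ^ k * l)"
      by (rule mult_le_mono1) (use C in simp)
    then have rkl: "r ^ k * l \<le> n" using n by linarith
    have "r ^ 1 * 1 \<le> r ^ k * l" by (intro mult_le_mono power_increasing) (use k r(3) l1 in auto)
    then have rn: "r \<le> n" using rkl by simp
    have "real n = 2 powr log 2 (real n)" using elim(2) by simp
    also have "\<dots> \<le> 2 powr real l" using l(3) by simp
    finally have "real n \<le> 2 ^ l" by (simp add: powr_realpow)
    then have "n \<le> 2 ^ l" by (simp flip: of_nat_le_iff)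
    \<comment> \<open>Both \<open>r\<close> and \<open>r ^ k * l\<close> are at most
      \<open>n\<close>, hence at most \<open>2 ^ l\<close>; a third factor \<open>2 ^ l\<close>
      absorbs the \<open>+ 1\<close>.\<close>
    then have "n * n \<le> 2 ^ l * 2 ^ l" by (rule mult_le_mono[OF _ \<open>n \<le> 2 ^ l\<close>])
    moreover have "r * (r ^ k * l) \<le> n * n" by (intro mult_le_mono rn rkl)
    ultimately have "r ^ Suc k * l + 1 \<le> 2 ^ l * 2 ^ l + 1" by (simp add: mult.assoc)
    also have "\<dots> \<le> 2 ^ l * 2 ^ l * 2" by (simp add: Suc_le_eq)
    also have "\<dots> \<le> 2 ^ l * 2 ^ l * 2 ^ l" using l1 by (cases l) auto
    also have "\<dots> = 2 ^ (3 * l)" by (simp flip: power_add)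
    finally have time: "r ^ Suc k * l + 1 \<le> 2 ^ (3 * l)" .
    have "r ^ Suc k * l \<le> sim_time Q M n"
    proof (rule sim_time_ge[OF _ _ n])
      fix j assume j: "j \<le> k"
      show "card (states Q) * ((r ^ Suc j * l + 1) * (card (symbols Q) + 1) ^ (2 * (r ^ j * l))) ^ k
          < 2 ^ (C * (r ^ j * l))"
        unfolding C_def by (rule code_count[OF sg _ l1 time j]) (use r(3) in simp)
    qed (use r(3) in simp)
    then have "real (r ^ Suc k * l) \<le> real (sim_time Q M n)" by (simp only: of_nat_le_iff)
    then have T: "real r ^ Suc k * real l \<le> real (sim_time Q M n)" by simp
    have "b * (real n powr (1 + 1 / real k) / ln (real n) powr (1 / real k)) =
        (\<rho> n / 2) ^ Suc k * ln (real n)"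
    proof -
      have "\<rho> n = real n powr (1 / real k) / (E powr (1 / real k) * ln (real n) powr (1 / real k))"
        using E ln by (simp add: \<rho>_def powr_divide powr_mult)
      moreover have "(\<rho> n / 2) ^ Suc k * ln (real n) = \<rho> n * ?x * ln (real n) / 2 ^ Suc k"
        by (simp add: power_divide \<rho>k)
      moreover have "?x * ln (real n) = real n / E" using ln by simp
      moreover have "real n powr (1 + 1 / real k) = real n * real n powr (1 / real k)"
        using elim(2) by (simp add: powr_add)
      ultimately show ?thesis by (simp add: b_def mult_ac)
    qed
    also have "\<dots> \<le> real r ^ Suc k * real l"
      using r(2) l(1) ln \<rho>3 by (intro mult_mono power_mono) auto
    also note T
    finally show ?case using ln by simp
  qed
  moreover have "0 < b" using E by (simp add: b_def)
  ultimately show ?thesis by (intro landau_omega.bigI)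
qed

end

theorem theorem1:
  fixes k :: nat
  assumes "k \<ge> 1"
  shows "\<forall>S \<in> {[blank_tape, empty_stack], [blank_tape, blank_tape],
                 [empty_stack, empty_stack, empty_stack]}.
           \<exists>M. is_machine M \<and> storage M = S \<and>
             (\<forall>Q. is_machine Q \<and> storage Q = replicate k empty_queue \<and> simulates_online Q M \<longrightarrow>
                (\<lambda>n. real (sim_time Q M n))
                  \<in> \<Omega>(\<lambda>n. real n powr (1 + 1 / real k) / ln (real n) powr (1 / real k)))"
proof
  fix S assume "S \<in> {[blank_tape, empty_stack], [blank_tape, blank_tape],
                 [empty_stack, empty_stack, empty_stack]}"
  \<comment> \<open>In each of the three storages the first device alone can hold the pushdown
    store.\<close>
  then obtain M where M: "is_machine M" "storage M = S" "serves M"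
    using tape_server[of "[empty_stack]"] tape_server[of "[blank_tape]"]
      stack_server[of "[empty_stack, empty_stack]"] by blast
  have "(\<lambda>n. real (sim_time Q M n))
      \<in> \<Omega>(\<lambda>n. real n powr (1 + 1 / real k) / ln (real n) powr (1 / real k))"
    if "is_machine Q" "storage Q = replicate k empty_queue" "simulates_online Q M" for Q
  proof -
    interpret simulation Q M k by standard (use M that in auto)
    show ?thesis by (rule sim_time_bigomega[OF assms])
  qed
  with M show "\<exists>M. is_machine M \<and> storage M = S \<and>
      (\<forall>Q. is_machine Q \<and> storage Q = replicate k empty_queue \<and> simulates_online Q M \<longrightarrow>
        (\<lambda>n. real (sim_time Q M n))
          \<in> \<Omega>(\<lambda>n. real n powr (1 + 1 / real k) / ln (real n) powr (1 / real k)))"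
    by blast
qed

end
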